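(* Let $G$ be a finite nonabelian simple group and let $\mathcal{D}=(\mathcal{P},\mathcal{B})$ be a design constructed from $G$ by Method 1 or by Method 2 (defined in the context). Then $\widetilde{x}\in\mathrm{Aut}(\mathcal{D})$ for all $x\in G$. The homomorphism $G\to\mathrm{Aut}(\mathcal{D})$, $x\mapsto\widetilde{x}$, is one-to-one and $G\cong\widetilde{G}$.
   Context: Method 1: $G$ acts as a primitive permutation group on a finite set $\Omega$; fix $\alpha\in\Omega$ and let $\Delta\neq\{\alpha\}$ be an orbit of the stabilizer $G_\alpha$. Put $\mathcal{P}=\Omega$ and $\mathcal{B}=\{\Delta^g:g\in G\}$. This is a $1$-$(|\Omega|,|\Delta|,|\Delta|)$ design. Here $u^x$ denotes the image of $u\in\Omega$ under $x\in G$. Method 2: $M$ is a maximal subgroup of $G$, $g\in M\setminus\{1\}$, $\mathcal{P}=g^G$ (the conjugacy class of $g$) and $\mathcal{B}=\{(M\cap g^G)^y:y\in G\}$. This is a $1$-$(|g^G|,|M\cap g^G|,1_M^G(g))$ design, $1_M^G$ being the permutation character of $G$ on the cosets of $M$. Here $u^x=x^{-1}ux$. $\mathrm{Aut}(\mathcal{D})$ is the group of permutations of $\mathcal{P}$ that map blocks to blocks (permutations are composed so as to be compatible with the right action of $G$). For $x\in G$, $\widetilde{x}$ acts on $\mathcal{D}$ by $u\mapsto u^x$ for $u\in\mathcal{P}$ and $B\mapsto B^x=\{u^x:u\in B\}$ for $B\in\mathcal{B}$, and $\widetilde{G}:=\{\widetilde{x}:x\in G\}$. *)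

theory Defs
  imports "HOL-Algebra.Group_Action" "HOL-Algebra.SimpleGroups"
begin

text \<open>
  The library's \<^locale>\<open>group_action\<close> is a left action. All actions here are on the right, written
  \<open>u\<^sup>x = \<phi> x u\<close> with \<open>(u\<^sup>x)\<^sup>y = u\<^sup>x\<^sup>y\<close>; a right action of a group is a left action of its opposite.
\<close>

definition opp_group :: "('a, 'm) monoid_scheme \<Rightarrow> ('a, 'm) monoid_scheme"
  where "opp_group G = G\<lparr>mult := \<lambda>x y. y \<otimes>\<^bsub>G\<^esub> x\<rparr>"

definition right_action :: "('a, 'm) monoid_scheme \<Rightarrow> 'p set \<Rightarrow> ('a \<Rightarrow> 'p \<Rightarrow> 'p) \<Rightarrow> bool"
  where "right_action G \<Omega> \<phi> \<longleftrightarrow> group_action (opp_group G) \<Omega> \<phi>"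

lemma right_action_mult:
  assumes "right_action G \<Omega> \<phi>" "u \<in> \<Omega>" "x \<in> carrier G" "y \<in> carrier G"
  shows "\<phi> (x \<otimes>\<^bsub>G\<^esub> y) u = \<phi> y (\<phi> x u)"
  using group_action.composition_rule[of "opp_group G" \<Omega> \<phi> u y x] assms
  by (simp add: right_action_def opp_group_def)

text \<open>
  Faithfulness is deliberately not part of the following notion: it says that the permutation group
  induced by \<open>G\<close> on \<open>\<Omega>\<close> is primitive (transitive, no nontrivial blocks of imprimitivity).
\<close>

definition primitive_right_action ::
    "('a, 'm) monoid_scheme \<Rightarrow> 'p set \<Rightarrow> ('a \<Rightarrow> 'p \<Rightarrow> 'p) \<Rightarrow> bool"
  where "primitive_right_action G \<Omega> \<phi> \<longleftrightarrow>
    right_action G \<Omega> \<phi> \<and>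
    (\<forall>u\<in>\<Omega>. \<forall>v\<in>\<Omega>. \<exists>x\<in>carrier G. \<phi> x u = v) \<and>
    (\<forall>S. S \<subseteq> \<Omega> \<and> S \<noteq> {} \<and> (\<forall>x\<in>carrier G. \<phi> x ` S = S \<or> \<phi> x ` S \<inter> S = {})
         \<longrightarrow> (\<exists>u. S = {u}) \<or> S = \<Omega>)"

definition maximal_subgroup :: "'a set \<Rightarrow> ('a, 'm) monoid_scheme \<Rightarrow> bool"
  where "maximal_subgroup M G \<longleftrightarrow>
    subgroup M G \<and> M \<noteq> carrier G \<and>
    (\<forall>H. subgroup H G \<and> M \<subseteq> H \<longrightarrow> H = M \<or> H = carrier G)"

definition conj_act :: "('a, 'm) monoid_scheme \<Rightarrow> 'a \<Rightarrow> 'a \<Rightarrow> 'a"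
  where "conj_act G x u = inv\<^bsub>G\<^esub> x \<otimes>\<^bsub>G\<^esub> u \<otimes>\<^bsub>G\<^esub> x"

type_synonym 'p design = "'p set \<times> 'p set set"

definition method1 :: "('a, 'm) monoid_scheme \<Rightarrow> 'p set \<Rightarrow> ('a \<Rightarrow> 'p \<Rightarrow> 'p) \<Rightarrow> 'p design \<Rightarrow> bool"
  where "method1 G \<Omega> \<phi> D \<longleftrightarrow>
    finite \<Omega> \<and> primitive_right_action G \<Omega> \<phi> \<and>
    (\<exists>\<alpha>\<in>\<Omega>. \<exists>\<Delta>\<in>orbits (G\<lparr>carrier := stabilizer G \<phi> \<alpha>\<rparr>) \<Omega> \<phi>.
       \<Delta> \<noteq> {\<alpha>} \<and> D = (\<Omega>, {\<phi> x ` \<Delta> | x. x \<in> carrier G}))"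

definition method2 :: "('a, 'm) monoid_scheme \<Rightarrow> 'a design \<Rightarrow> bool"
  where "method2 G D \<longleftrightarrow>
    (\<exists>M g. maximal_subgroup M G \<and> g \<in> M - {\<one>\<^bsub>G\<^esub>} \<and>
       D = (orbit G (conj_act G) g,
            {conj_act G y ` (M \<inter> orbit G (conj_act G) g) | y. y \<in> carrier G}))"

text \<open>
  Permutations of the points are extensional functions, as in \<^const>\<open>BijGroup\<close>; the product \<open>f g\<close>
  means first \<open>f\<close>, then \<open>g\<close>.
\<close>

definition aut_group :: "'p design \<Rightarrow> ('p \<Rightarrow> 'p) monoid"
  where "aut_group D = (opp_group (BijGroup (fst D)))
    \<lparr>carrier := {f \<in> Bij (fst D). \<forall>B\<in>snd D. f ` B \<in> snd D}\<rparr>"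

definition tilde :: "('a \<Rightarrow> 'p \<Rightarrow> 'p) \<Rightarrow> 'p design \<Rightarrow> 'a \<Rightarrow> 'p \<Rightarrow> 'p"
  where "tilde \<phi> D x = (\<lambda>u\<in>fst D. \<phi> x u)"

definition tilde_group ::
    "('a, 'm) monoid_scheme \<Rightarrow> ('a \<Rightarrow> 'p \<Rightarrow> 'p) \<Rightarrow> 'p design \<Rightarrow> ('p \<Rightarrow> 'p) monoid"
  where "tilde_group G \<phi> D = (aut_group D)\<lparr>carrier := tilde \<phi> D ` carrier G\<rparr>"

end

theory Submission
  imports Defs
begin

text \<open>
  Both methods produce a design of the same shape: a finite set \<open>P\<close> on which \<open>G\<close> acts from the
  right, with the translates of one base block \<open>\<Delta> \<subseteq> P\<close> as blocks. Translating a translate again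
  gives a translate, so every \<open>x\<close> in \<open>G\<close> induces an automorphism, and the axioms of a right action
  say that \<open>x \<mapsto> tilde \<phi> D x\<close> is a homomorphism. Since \<open>P\<close> is finite, its target \<open>aut_group D\<close>
  is closed under inverses (\<open>inverse_maps_blocks\<close>). The kernel is normal, so by simplicity it is
  trivial unless \<open>G\<close> fixes every point of \<open>P\<close> (\<open>tilde_inj_on\<close>). A trivial kernel makes the map
  an isomorphism onto its image.

  It remains to exclude the trivial action, and this is where the two methods differ. In Method 1 a
  transitive trivial action has a single point \<open>\<alpha>\<close>, and the only orbit of its stabilizer is
  \<open>{\<alpha>}\<close>, which is not allowed as base block. In Method 2 a trivial action by conjugation
  makes \<open>g \<noteq> \<one>\<close> central, while the centre of a nonabelian simple group is trivial
  (\<open>central_imp_one\<close>).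
\<close>

section \<open>Automorphism groups of finite designs\<close>

lemma aut_group_simps:
  "carrier (aut_group (P, \<B>)) = {f \<in> Bij P. \<forall>B\<in>\<B>. f ` B \<in> \<B>}"
  "\<one>\<^bsub>aut_group (P, \<B>)\<^esub> = (\<lambda>u\<in>P. u)"
  "f \<in> Bij P \<Longrightarrow> h \<in> Bij P \<Longrightarrow> f \<otimes>\<^bsub>aut_group (P, \<B>)\<^esub> h = compose P h f"
  by (simp_all add: aut_group_def opp_group_def BijGroup_def)

lemma compose_image: "B \<subseteq> P \<Longrightarrow> compose P h f ` B = h ` f ` B"
  by (auto simp: compose_def image_iff subset_iff)

text \<open>
  An automorphism is only required to map blocks to blocks. Its inverse does the same because an
  injective self-map of the finite set of blocks is onto.
\<close>

lemma inverse_maps_blocks: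
  assumes "finite P" and blocks: "\<And>B. B \<in> \<B> \<Longrightarrow> B \<subseteq> P"
    and f: "f \<in> Bij P" and maps: "\<forall>B\<in>\<B>. f ` B \<in> \<B>" and "B \<in> \<B>"
  shows "(\<lambda>u\<in>P. inv_into P f u) ` B \<in> \<B>"
proof -
  have inj: "inj_on f P"
    using f by (simp add: Bij_def bij_betw_def)
  have "finite \<B>"
    using \<open>finite P\<close> blocks by (meson Pow_iff finite_Pow_iff finite_subset subsetI)
  moreover have "inj_on ((`) f) \<B>"
    using blocks by (intro inj_on_image inj_on_subset[OF inj]) blast
  ultimately have "(`) f ` \<B> = \<B>"
    using maps by (intro endo_inj_surj) auto
  then obtain C where C: "C \<in> \<B>" "B = f ` C"
    using \<open>B \<in> \<B>\<close> by blast
  have "(\<lambda>u\<in>P. inv_into P f u) ` B = inv_into P f ` B"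
    using blocks[OF \<open>B \<in> \<B>\<close>] by (intro image_cong) auto
  also have "\<dots> = C"
    using C inj blocks by (simp add: inv_into_image_cancel)
  finally show ?thesis
    using C by simp
qed

lemma group_aut_group:
  assumes "finite P" and blocks: "\<And>B. B \<in> \<B> \<Longrightarrow> B \<subseteq> P"
  shows "group (aut_group (P, \<B>))"
proof (rule groupI)
  fix f h
  assume "f \<in> carrier (aut_group (P, \<B>))" "h \<in> carrier (aut_group (P, \<B>))"
  then show "f \<otimes>\<^bsub>aut_group (P, \<B>)\<^esub> h \<in> carrier (aut_group (P, \<B>))"
    using blocks by (auto simp: aut_group_simps compose_Bij compose_image)
next
  have "(\<lambda>u\<in>P. u) ` B = B" if "B \<in> \<B>" for B
    using blocks[OF that] by (auto simp: image_iff subset_iff)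
  then show "\<one>\<^bsub>aut_group (P, \<B>)\<^esub> \<in> carrier (aut_group (P, \<B>))"
    by (simp add: aut_group_simps id_Bij)
next
  fix f h k
  assume "f \<in> carrier (aut_group (P, \<B>))" "h \<in> carrier (aut_group (P, \<B>))"
    "k \<in> carrier (aut_group (P, \<B>))"
  then show "f \<otimes>\<^bsub>aut_group (P, \<B>)\<^esub> h \<otimes>\<^bsub>aut_group (P, \<B>)\<^esub> k =
      f \<otimes>\<^bsub>aut_group (P, \<B>)\<^esub> (h \<otimes>\<^bsub>aut_group (P, \<B>)\<^esub> k)"
    by (simp add: aut_group_simps compose_Bij compose_assoc[OF Bij_imp_funcset])
next
  fix f
  assume "f \<in> carrier (aut_group (P, \<B>))"
  then show "\<one>\<^bsub>aut_group (P, \<B>)\<^esub> \<otimes>\<^bsub>aut_group (P, \<B>)\<^esub> f = f"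
    by (auto simp: aut_group_simps id_Bij compose_def fun_eq_iff
        extensional_arb[OF Bij_imp_extensional])
next
  fix f
  assume "f \<in> carrier (aut_group (P, \<B>))"
  then have f: "f \<in> Bij P" "\<forall>B\<in>\<B>. f ` B \<in> \<B>"
    by (simp_all add: aut_group_simps)
  let ?h = "\<lambda>u\<in>P. inv_into P f u"
  have h: "?h \<in> Bij P"
    using f by (intro restrict_inv_into_Bij)
  moreover have "\<forall>B\<in>\<B>. ?h ` B \<in> \<B>"
    using inverse_maps_blocks[OF assms f] by blast
  moreover have "compose P f ?h = (\<lambda>u\<in>P. u)"
    using f by (intro compose_id_inv_into) (simp add: Bij_def bij_betw_def)
  ultimately show "\<exists>h\<in>carrier (aut_group (P, \<B>)).
      h \<otimes>\<^bsub>aut_group (P, \<B>)\<^esub> f = \<one>\<^bsub>aut_group (P, \<B>)\<^esub>"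
    using f by (intro bexI[of _ ?h]) (simp_all add: aut_group_simps)
qed

section \<open>Designs formed by the translates of a base block\<close>

text \<open>
  The right action is given by its pointwise laws on \<open>P\<close> and not as a \<^locale>\<open>group_action\<close> of the
  opposite group, whose maps are extensional. Conjugation is defined on the whole type, so it
  satisfies the pointwise laws on a conjugacy class but is not extensional there.
\<close>

locale translate_design = group G for G :: "('a, 'm) monoid_scheme" (structure) +
  fixes P :: "'p set" and \<phi> :: "'a \<Rightarrow> 'p \<Rightarrow> 'p" and \<Delta> :: "'p set"
  assumes finite_points: "finite P"
    and act_closed: "x \<in> carrier G \<Longrightarrow> u \<in> P \<Longrightarrow> \<phi> x u \<in> P"
    and act_one: "u \<in> P \<Longrightarrow> \<phi> \<one> u = u"
    and act_mult: "x \<in> carrier G \<Longrightarrow> y \<in> carrier G \<Longrightarrow> u \<in> P \<Longrightarrow> \<phi> (x \<otimes> y) u = \<phi> y (\<phi> x u)"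
    and base_block: "\<Delta> \<subseteq> P"
begin

definition blocks where "blocks = {\<phi> x ` \<Delta> | x. x \<in> carrier G}"

abbreviation design where "design \<equiv> (P, blocks)"

lemma blocks_subset: "B \<in> blocks \<Longrightarrow> B \<subseteq> P"
  using base_block act_closed by (auto simp: blocks_def)

lemma tilde_Bij:
  assumes "x \<in> carrier G"
  shows "tilde \<phi> design x \<in> Bij P"
proof -
  have "bij_betw (\<phi> x) P P"
    using assms act_closed
    by (intro bij_betwI[where g = "\<phi> (inv x)"])
      (auto simp: act_mult[symmetric] act_one)
  then show ?thesis
    by (simp add: tilde_def Bij_def)
qed

lemma tilde_mult:
  assumes "x \<in> carrier G" "y \<in> carrier G"
  shows "tilde \<phi> design (x \<otimes> y) = tilde \<phi> design x \<otimes>\<^bsub>aut_group design\<^esub> tilde \<phi> design y"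
proof -
  have "tilde \<phi> design (x \<otimes> y) = compose P (tilde \<phi> design y) (tilde \<phi> design x)"
    using assms by (auto simp: tilde_def compose_def act_mult act_closed)
  then show ?thesis
    using assms by (simp add: aut_group_simps tilde_Bij)
qed

lemma tilde_in_aut:
  assumes "x \<in> carrier G"
  shows "tilde \<phi> design x \<in> carrier (aut_group design)"
proof -
  have "tilde \<phi> design x ` B \<in> blocks" if B: "B \<in> blocks" for B
  proof -
    obtain y where y: "y \<in> carrier G" "B = \<phi> y ` \<Delta>"
      using B by (auto simp: blocks_def)
    have "tilde \<phi> design x ` B = \<phi> x ` B"
      using blocks_subset[OF B] by (intro image_cong) (auto simp: tilde_def)
    also have "\<dots> = \<phi> (y \<otimes> x) ` \<Delta>"
      unfolding y(2) image_image
      using act_mult[OF y(1) assms] base_block by (intro image_cong) auto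
    finally show ?thesis
      unfolding blocks_def using y(1) assms by blast
  qed
  then show ?thesis
    using tilde_Bij[OF assms] by (simp add: aut_group_simps)
qed

lemma group_hom_tilde: "group_hom G (aut_group design) (tilde \<phi> design)"
  using group_aut_group[OF finite_points blocks_subset] tilde_in_aut tilde_mult
  by (auto simp: group_hom_def group_hom_axioms_def hom_def is_group)

lemma tilde_eq_one_iff:
  "tilde \<phi> design x = \<one>\<^bsub>aut_group design\<^esub> \<longleftrightarrow> (\<forall>u\<in>P. \<phi> x u = u)"
  by (auto simp: aut_group_simps tilde_def restrict_def fun_eq_iff)

lemma tilde_inj_on:
  assumes "simple_group G" and nontrivial: "\<not> (\<forall>x\<in>carrier G. \<forall>u\<in>P. \<phi> x u = u)"
  shows "inj_on (tilde \<phi> design) (carrier G)"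
proof -
  interpret tilde: group_hom G "aut_group design" "tilde \<phi> design"
    by (rule group_hom_tilde)
  let ?K = "kernel G (aut_group design) (tilde \<phi> design)"
  have "?K \<noteq> carrier G"
    using nontrivial by (auto simp: kernel_def tilde_eq_one_iff)
  then have "?K = {\<one>}"
    using simple_group.no_real_normal_subgroup[OF assms(1) tilde.normal_kernel] by blast
  then show ?thesis
    by (rule tilde.trivial_ker_imp_inj)
qed

lemma iso_tilde_group:
  assumes "inj_on (tilde \<phi> design) (carrier G)"
  shows "G \<cong> tilde_group G \<phi> design"
proof (rule is_isoI, rule isoI)
  show "tilde \<phi> design \<in> hom G (tilde_group G \<phi> design)"
    using tilde_mult by (auto simp: hom_def tilde_group_def)
  show "bij_betw (tilde \<phi> design) (carrier G) (carrier (tilde_group G \<phi> design))"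
    using assms by (simp add: tilde_group_def bij_betw_def)
qed

end

section \<open>The two methods\<close>

text \<open>
  The action is nontrivial because \<open>\<Delta> \<noteq> {\<alpha>}\<close>: transitivity would collapse a trivial action
  to one point, and then \<open>{\<alpha>}\<close> is the only candidate for \<open>\<Delta>\<close>.
\<close>

lemma method1_translate_design:
  fixes G (structure)
  assumes "group G" and "method1 G \<Omega> \<phi> D"
  obtains \<Delta> where "translate_design G \<Omega> \<phi> \<Delta>"
    and "D = (\<Omega>, translate_design.blocks G \<phi> \<Delta>)"
    and "\<not> (\<forall>x\<in>carrier G. \<forall>u\<in>\<Omega>. \<phi> x u = u)"
proof -
  interpret group G by fact
  from assms(2) obtain \<alpha> \<Delta> where "finite \<Omega>" and \<alpha>: "\<alpha> \<in> \<Omega>"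
    and orb: "\<Delta> \<in> orbits (G\<lparr>carrier := stabilizer G \<phi> \<alpha>\<rparr>) \<Omega> \<phi>" and "\<Delta> \<noteq> {\<alpha>}"
    and D: "D = (\<Omega>, {\<phi> x ` \<Delta> | x. x \<in> carrier G})"
    and act: "right_action G \<Omega> \<phi>"
    and trans: "\<forall>u\<in>\<Omega>. \<forall>v\<in>\<Omega>. \<exists>x\<in>carrier G. \<phi> x u = v"
    by (auto simp: method1_def primitive_right_action_def)
  interpret opp: group_action "opp_group G" \<Omega> \<phi>
    using act by (simp add: right_action_def)
  have closed: "\<phi> x u \<in> \<Omega>" if "x \<in> carrier G" "u \<in> \<Omega>" for x u
    using opp.element_image[of x u] that by (simp add: opp_group_def)
  have one: "\<phi> \<one> u = u" if "u \<in> \<Omega>" for u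
    using fun_cong[OF opp.id_eq_one, of u] that by (simp add: opp_group_def)
  obtain u where u: "u \<in> \<Omega>" and \<Delta>: "\<Delta> = {\<phi> x u | x. x \<in> stabilizer G \<phi> \<alpha>}"
    using orb by (auto simp: orbits_def orbit_def)
  have "\<Delta> \<subseteq> \<Omega>"
    using closed u by (auto simp: \<Delta> stabilizer_def)
  then interpret translate_design G \<Omega> \<phi> \<Delta>
    using \<open>finite \<Omega>\<close> closed one right_action_mult[OF act] by unfold_locales auto
  have "\<not> (\<forall>x\<in>carrier G. \<forall>u\<in>\<Omega>. \<phi> x u = u)"
  proof
    assume fixed: "\<forall>x\<in>carrier G. \<forall>u\<in>\<Omega>. \<phi> x u = u"
    then have "u = \<alpha>"
      using trans u \<alpha> by metis
    moreover have "\<one> \<in> stabilizer G \<phi> \<alpha>"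
      using one \<alpha> by (simp add: stabilizer_def)
    ultimately have "\<Delta> = {\<alpha>}"
      unfolding \<Delta> using one[OF \<alpha>] by (force simp: stabilizer_def)
    with \<open>\<Delta> \<noteq> {\<alpha>}\<close> show False ..
  qed
  then show thesis
    using that translate_design_axioms D by (simp add: blocks_def)
qed

lemma (in group) centre_normal:
  "{z \<in> carrier G. \<forall>x\<in>carrier G. x \<otimes> z = z \<otimes> x} \<lhd> G"
proof -
  let ?Z = "{z \<in> carrier G. \<forall>x\<in>carrier G. x \<otimes> z = z \<otimes> x}"
  have "subgroup ?Z G"
  proof (rule subgroupI)
    have "\<one> \<in> ?Z"
      by simp
    then show "?Z \<noteq> {}"
      by blast
  next
    fix z
    assume "z \<in> ?Z"
    then have z: "z \<in> carrier G" and comm: "\<And>x. x \<in> carrier G \<Longrightarrow> x \<otimes> z = z \<otimes> x"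
      by blast+
    have "x \<otimes> inv z = inv z \<otimes> x" if x: "x \<in> carrier G" for x
    proof -
      have "z \<otimes> (x \<otimes> inv z) = x"
        using x z comm[OF x, symmetric] by (simp add: m_assoc[symmetric]) (simp add: m_assoc)
      then show ?thesis
        using x z inv_solve_left[of "x \<otimes> inv z" z x] by simp
    qed
    then show "inv z \<in> ?Z"
      using inv_closed[OF z] by blast
  next
    fix z w
    assume "z \<in> ?Z" "w \<in> ?Z"
    then have z: "z \<in> carrier G" "\<And>x. x \<in> carrier G \<Longrightarrow> x \<otimes> z = z \<otimes> x"
      and w: "w \<in> carrier G" "\<And>x. x \<in> carrier G \<Longrightarrow> x \<otimes> w = w \<otimes> x"
      by blast+
    have "x \<otimes> (z \<otimes> w) = z \<otimes> w \<otimes> x" if x: "x \<in> carrier G" for x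
    proof -
      have "x \<otimes> (z \<otimes> w) = z \<otimes> (x \<otimes> w)"
        using x z(1) w(1) z(2)[OF x] by (metis m_assoc)
      also have "\<dots> = z \<otimes> w \<otimes> x"
        using x z(1) w(1) w(2)[OF x] by (simp add: m_assoc)
      finally show ?thesis .
    qed
    then show "z \<otimes> w \<in> ?Z"
      using m_closed[OF z(1) w(1)] by blast
  qed auto
  moreover have "x \<otimes> z \<otimes> inv x \<in> ?Z" if "x \<in> carrier G" "z \<in> ?Z" for x z
  proof -
    have "x \<otimes> z = z \<otimes> x" "z \<in> carrier G"
      using that by blast+
    then have "x \<otimes> z \<otimes> inv x = z"
      using that(1) by (simp add: m_assoc)
    with that(2) show ?thesis by simp
  qed
  ultimately show ?thesis
    by (simp add: normal_inv_iff)
qed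

lemma (in simple_group) central_imp_one:
  assumes "\<not> comm_group G" and "z \<in> carrier G" and "\<And>x. x \<in> carrier G \<Longrightarrow> x \<otimes> z = z \<otimes> x"
  shows "z = \<one>"
proof -
  let ?Z = "{z \<in> carrier G. \<forall>x\<in>carrier G. x \<otimes> z = z \<otimes> x}"
  have "?Z \<noteq> carrier G"
  proof
    assume "?Z = carrier G"
    then have "comm_group G"
      by (intro group_comm_groupI) blast
    with assms(1) show False ..
  qed
  then have "?Z = {\<one>}"
    using no_real_normal_subgroup[OF centre_normal] by blast
  then show ?thesis
    using assms by blast
qed

text \<open>
  The action is nontrivial because \<open>g\<close> lies in its own conjugacy class: if \<open>G\<close> fixed \<open>g\<close> under
  conjugation, then \<open>g\<close> would be central, hence \<open>\<one>\<close>.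
\<close>

lemma method2_translate_design:
  fixes G (structure)
  assumes "simple_group G" "finite (carrier G)" "\<not> comm_group G" and "method2 G D"
  obtains P \<Delta> where "translate_design G P (conj_act G) \<Delta>"
    and "D = (P, translate_design.blocks G (conj_act G) \<Delta>)"
    and "\<not> (\<forall>x\<in>carrier G. \<forall>u\<in>P. conj_act G x u = u)"
proof -
  interpret simple_group G by fact
  from assms(4) obtain M g where M: "subgroup M G" and g: "g \<in> M" "g \<noteq> \<one>"
    and D: "D = (orbit G (conj_act G) g,
      {conj_act G y ` (M \<inter> orbit G (conj_act G) g) | y. y \<in> carrier G})"
    by (auto simp: method2_def maximal_subgroup_def)
  let ?P = "orbit G (conj_act G) g"
  have gG: "g \<in> carrier G"
    using subgroup.mem_carrier[OF M g(1)] .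
  have one: "conj_act G \<one> u = u" if "u \<in> carrier G" for u
    using that by (simp add: conj_act_def)
  have mult: "conj_act G (x \<otimes> y) u = conj_act G y (conj_act G x u)"
    if "x \<in> carrier G" "y \<in> carrier G" "u \<in> carrier G" for x y u
    using that by (simp add: conj_act_def inv_mult_group m_assoc)
  have sub: "?P \<subseteq> carrier G"
    using gG by (auto simp: orbit_def conj_act_def)
  have closed: "conj_act G x u \<in> ?P" if "x \<in> carrier G" "u \<in> ?P" for x u
    using that gG by (force simp: orbit_def mult[symmetric])
  interpret translate_design G ?P "conj_act G" "M \<inter> ?P"
    using assms(2) sub closed one mult by unfold_locales (auto intro: finite_subset)
  have "\<not> (\<forall>x\<in>carrier G. \<forall>u\<in>?P. conj_act G x u = u)"
  proof
    assume fixed: "\<forall>x\<in>carrier G. \<forall>u\<in>?P. conj_act G x u = u"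
    have "g \<in> ?P"
      using one[OF gG] by (force simp: orbit_def)
    have "x \<otimes> g = g \<otimes> x" if x: "x \<in> carrier G" for x
    proof -
      have "inv x \<otimes> g \<otimes> x = g"
        using bspec[OF bspec[OF fixed x] \<open>g \<in> ?P\<close>] by (simp add: conj_act_def)
      then have "inv x \<otimes> (g \<otimes> x) = g"
        using x gG by (simp add: m_assoc)
      then show ?thesis
        using x gG inv_solve_left'[of g x "g \<otimes> x"] by simp
    qed
    then show False
      using central_imp_one[OF assms(3) gG] g by blast
  qed
  then show thesis
    using that translate_design_axioms D by (simp add: blocks_def)
qed

theorem lemma2p2:
  fixes G :: "('a, 'm) monoid_scheme"
    and \<Omega> :: "'p set" and \<phi> :: "'a \<Rightarrow> 'p \<Rightarrow> 'p"
    and D1 :: "'p design" and D2 :: "'a design"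
  assumes "simple_group G" and "finite (carrier G)" and "\<not> comm_group G"
  shows "(method1 G \<Omega> \<phi> D1 \<longrightarrow>
            (\<forall>x\<in>carrier G. tilde \<phi> D1 x \<in> carrier (aut_group D1)) \<and>
            group_hom G (aut_group D1) (tilde \<phi> D1) \<and>
            inj_on (tilde \<phi> D1) (carrier G) \<and>
            G \<cong> tilde_group G \<phi> D1) \<and>
         (method2 G D2 \<longrightarrow>
            (\<forall>x\<in>carrier G. tilde (conj_act G) D2 x \<in> carrier (aut_group D2)) \<and>
            group_hom G (aut_group D2) (tilde (conj_act G) D2) \<and>
            inj_on (tilde (conj_act G) D2) (carrier G) \<and>
            G \<cong> tilde_group G (conj_act G) D2)"
proof (intro conjI[of "_ \<longrightarrow> _" "_ \<longrightarrow> _"] impI)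
  assume "method1 G \<Omega> \<phi> D1"
  then obtain \<Delta> where "translate_design G \<Omega> \<phi> \<Delta>"
    and D: "D1 = (\<Omega>, translate_design.blocks G \<phi> \<Delta>)"
    and nontrivial: "\<not> (\<forall>x\<in>carrier G. \<forall>u\<in>\<Omega>. \<phi> x u = u)"
    using method1_translate_design simple_group.axioms(1)[OF assms(1)] by metis
  then interpret translate_design G \<Omega> \<phi> \<Delta> by simp
  show "(\<forall>x\<in>carrier G. tilde \<phi> D1 x \<in> carrier (aut_group D1)) \<and>
      group_hom G (aut_group D1) (tilde \<phi> D1) \<and>
      inj_on (tilde \<phi> D1) (carrier G) \<and>
      G \<cong> tilde_group G \<phi> D1"
    using tilde_in_aut group_hom_tilde tilde_inj_on[OF assms(1) nontrivial] iso_tilde_group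
    unfolding D by blast
next
  assume "method2 G D2"
  then obtain P \<Delta> where "translate_design G P (conj_act G) \<Delta>"
    and D: "D2 = (P, translate_design.blocks G (conj_act G) \<Delta>)"
    and nontrivial: "\<not> (\<forall>x\<in>carrier G. \<forall>u\<in>P. conj_act G x u = u)"
    using method2_translate_design[OF assms] by metis
  then interpret translate_design G P "conj_act G" \<Delta> by simp
  show "(\<forall>x\<in>carrier G. tilde (conj_act G) D2 x \<in> carrier (aut_group D2)) \<and>
      group_hom G (aut_group D2) (tilde (conj_act G) D2) \<and>
      inj_on (tilde (conj_act G) D2) (carrier G) \<and>
      G \<cong> tilde_group G (conj_act G) D2"
    using tilde_in_aut group_hom_tilde tilde_inj_on[OF assms(1) nontrivial] iso_tilde_group
    unfolding D by blast
qed

end
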